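(* Let $k \ge 0$ be an integer, let $d = 2k+1$, and let $n \geq d$ be an integer. Then the elementary symmetric polynomial $\sigma_{d,n} \in \mathbb{C}[x_1,\dots,x_n]$ admits the power sum decomposition $$2^{d-1}\, d!\, \sigma_{d,n} = \sum_{I \subset [n],\ |I| \leq k} (-1)^{|I|} \binom{n-k-|I|-1}{k-|I|} \bigl(\delta(I,1) x_1 + \delta(I,2) x_2 + \dots + \delta(I,n) x_n\bigr)^d .$$
   Context: $[n] = \{1,2,\dots,n\}$. For a set of integers $I$ and an integer $i$, $\delta(I,i) = -1$ if $i \in I$ and $\delta(I,i) = 1$ otherwise. The elementary symmetric polynomial is $\sigma_{d,n} = \sum_{I \subset [n], |I| = d} \prod_{i \in I} x_i$. The sum in the claim runs over all subsets $I$ of $[n]$ (including the empty set) with $|I|\le k$. *)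

theory Defs
  imports Complex_Main "HOL-Library.Poly_Mapping"
begin

text \<open>
  A monomial is a finitely supported exponent vector \<open>nat \<Rightarrow>\<^sub>0 nat\<close>; a polynomial maps finitely
  many monomials to non-zero coefficients, and the product is the convolution product.
  The variables are indexed by all natural numbers. The ring \<open>\<complex>[x\<^sub>1,\<dots>,x\<^sub>n]\<close> is the subring
  of polynomials in \<open>x\<^sub>1,\<dots>,x\<^sub>n\<close>, so an identity between such polynomials holds there if and
  only if it holds here.
\<close>

type_synonym cpoly = "(nat \<Rightarrow>\<^sub>0 nat) \<Rightarrow>\<^sub>0 complex"

definition Var :: "nat \<Rightarrow> cpoly" where
  "Var i = Poly_Mapping.single (Poly_Mapping.single i 1) 1"

definition Const :: "complex \<Rightarrow> cpoly" where
  "Const c = Poly_Mapping.single 0 c"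

definition elem_sym :: "nat \<Rightarrow> nat \<Rightarrow> cpoly" where
  "elem_sym d n = (\<Sum>I | I \<subseteq> {1..n} \<and> card I = d. \<Prod>i\<in>I. Var i)"

definition delta :: "'a set \<Rightarrow> 'a \<Rightarrow> complex" where
  "delta I i = (if i \<in> I then -1 else 1)"

end

theory Submission
  imports Defs "HOL-Computational_Algebra.Polynomial_FPS" "HOL-Library.FuncSet"
begin

text \<open>
  Write \<open>d = 2k + 1\<close> and \<open>n = d + m\<close>. Expanding the \<open>d\<close>-th power of a signed sum of the \<open>x\<^sub>i\<close> gives one
  product \<open>x\<^bsub>f 0\<^esub> \<cdots> x\<^bsub>f (d-1)\<^esub>\<close> for every function \<open>f\<close> from \<open>d\<close> positions to the \<open>n\<close> indices. It therefore
  suffices to see that, after summing over \<open>I\<close>, the coefficient belonging to \<open>f\<close> is \<open>2^(2k)\<close> if \<open>f\<close> is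
  injective and \<open>0\<close> otherwise: each squarefree monomial of degree \<open>d\<close> arises from exactly \<open>d!\<close>
  injective functions (\<open>sum_prod_injective_functions\<close>).

  The coefficient of \<open>f\<close> is read off from a generating function. The sign contributed by \<open>I\<close> is the
  product over \<open>i \<in> I\<close> of \<open>e\<^sub>i = \<plusminus>1\<close>, with \<open>e\<^sub>i = -1\<close> iff the fibre of \<open>f\<close> over \<open>i\<close> is odd. The binomial
  weight of \<open>I\<close> is the coefficient of \<open>z^(k - |I|)\<close> in \<open>(1 - z)^(-(m+1))\<close>. Hence the coefficient of \<open>f\<close>
  is that of \<open>z^k\<close> in
  \<open>(1 - z)^(-(m+1)) \<Prod>\<^sub>i (1 - e\<^sub>i z) = (1 + z)^s (1 - z)^(2k - s)\<close>,
  where \<open>s\<close> is the number of odd fibres (\<open>weighted_subset_sum_eq_coeff\<close>). Since \<open>d\<close> is odd, so is \<open>s\<close>.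

  If \<open>s \<le> 2k\<close>, the right-hand side is a polynomial of degree \<open>2k\<close> whose coefficient sequence changes
  sign when reversed, so its middle coefficient vanishes (\<open>antipalindromic_middle_coeff\<close>). If
  \<open>s = 2k + 1\<close>, which means that \<open>f\<close> is injective, the right-hand side is \<open>(1 + z)^(2k+1) / (1 - z)\<close>,
  whose \<open>k\<close>-th coefficient is the sum of the first half of a row of Pascal's triangle, namely
  \<open>2^(2k)\<close> (\<open>half_binomial_row_coeff\<close>).
\<close>

section \<open>The negative binomial series\<close>

definition neg_binomial_fps :: "nat \<Rightarrow> int fps" where
  "neg_binomial_fps m = Abs_fps (\<lambda>j. int ((m + j) choose j))"

lemma neg_binomial_fps_nth [simp]: "fps_nth (neg_binomial_fps m) j = int ((m + j) choose j)"
  by (simp add: neg_binomial_fps_def)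

lemma neg_binomial_fps_0: "neg_binomial_fps 0 * (1 - fps_X) = 1"
proof (rule fps_ext)
  fix j show "fps_nth (neg_binomial_fps 0 * (1 - fps_X)) j = fps_nth 1 j"
    by (cases j) (simp_all add: right_diff_distrib)
qed

text \<open>Multiplying by \<open>1 - z\<close> takes differences of coefficients, so this is Pascal's rule.\<close>

lemma neg_binomial_fps_Suc: "neg_binomial_fps (Suc m) * (1 - fps_X) = neg_binomial_fps m"
proof (rule fps_ext)
  fix j show "fps_nth (neg_binomial_fps (Suc m) * (1 - fps_X)) j = fps_nth (neg_binomial_fps m) j"
    by (cases j) (simp_all add: right_diff_distrib)
qed

text \<open>
  The series is thus \<open>(1 - z)^(-(m+1))\<close>. Stating this as a product rather than with \<^const>\<open>inverse\<close>
  keeps everything over the integers.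
\<close>

lemma neg_binomial_fps_mult_power: "neg_binomial_fps m * (1 - fps_X) ^ Suc m = 1"
proof (induction m)
  case 0
  then show ?case by (simp add: neg_binomial_fps_0)
next
  case (Suc m)
  have "neg_binomial_fps (Suc m) * (1 - fps_X) ^ Suc (Suc m)
      = (neg_binomial_fps (Suc m) * (1 - fps_X)) * (1 - fps_X) ^ Suc m"
    by (simp add: mult_ac)
  then show ?case
    by (simp only: neg_binomial_fps_Suc Suc.IH)
qed

section \<open>Extracting the middle coefficient\<close>

text \<open>
  Reversing coefficients is multiplicative; it fixes \<open>1 + z\<close> and negates \<open>1 - z\<close>. For odd \<open>t\<close> the
  product therefore equals minus its reversal, and the reversal of a polynomial of degree \<open>2k\<close>
  leaves the \<open>k\<close>-th coefficient in place.
\<close>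

lemma antipalindromic_middle_coeff:
  assumes "s + t = 2 * k" and "odd t"
  shows "fps_nth ((1 + fps_X) ^ s * (1 - fps_X) ^ t :: int fps) k = 0"
proof -
  define P :: "int poly" where "P = [:1, 1:] ^ s * [:1, -1:] ^ t"
  have refl_p: "reflect_poly [:1, 1::int:] = [:1, 1:]"
    by (simp add: reflect_poly_pCons)
  have refl_m: "reflect_poly [:1, -1::int:] = - [:1, -1:]"
    by (simp add: reflect_poly_pCons)
  have "reflect_poly P = - P"
    unfolding P_def reflect_poly_mult reflect_poly_power refl_p refl_m
    by (simp only: power_minus_odd[OF \<open>odd t\<close>] mult_minus_right)
  moreover have deg: "degree P = 2 * k"
    unfolding P_def using assms(1)
    by (subst degree_mult_eq) (auto simp: degree_power_eq)
  ultimately have "coeff P k = 0"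
    using coeff_reflect_poly[of P k] by simp
  moreover have "fps_of_poly P = (1 + fps_X) ^ s * (1 - fps_X) ^ t"
    by (simp add: P_def fps_of_poly_mult fps_of_poly_power fps_of_poly_pCons)
  ultimately show ?thesis
    by (metis fps_of_poly_nth)
qed

text \<open>
  Multiplication by \<open>1 / (1 - z)\<close> forms partial sums of coefficients; by the symmetry of the odd row
  \<open>2k + 1\<close> its first half sums to half of \<open>2^(2k+1)\<close>.
\<close>

lemma half_binomial_row_coeff:
  "fps_nth (neg_binomial_fps 0 * (1 + fps_X) ^ (2 * k + 1)) k = 2 ^ (2 * k)"
proof -
  have c: "fps_nth ((1 + fps_X) ^ N :: int fps) i = int (N choose i)" for N i
  proof (induction N arbitrary: i)
    case 0
    then show ?case by (cases i) simp_all
  next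
    case (Suc N)
    then show ?case by (cases i) (simp_all add: distrib_right)
  qed
  have "fps_nth (neg_binomial_fps 0 * (1 + fps_X) ^ (2 * k + 1)) k
      = (\<Sum>i\<le>k. int ((2 * k + 1) choose i))"
    unfolding mult.commute[of "neg_binomial_fps 0"] fps_mult_nth c
    by (simp add: atLeast0AtMost)
  also have "\<dots> = int (\<Sum>i\<le>k. (2 * k + 1) choose i)"
    by simp
  finally show ?thesis
    by (simp only: binomial_r_part_sum) simp
qed

text \<open>
  The factor \<open>(1 - z)^(-(m+1))\<close> cancels against the power of \<open>1 - z\<close>, whose exponent is
  \<open>(2k - s) + (m + 1)\<close>. This leaves a polynomial unless \<open>s = 2k + 1\<close>, when one factor \<open>1 / (1 - z)\<close>
  survives.
\<close>

lemma generating_function_coeff: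
  assumes "odd s" and "s \<le> 2 * k + 1"
  shows "fps_nth (neg_binomial_fps m * ((1 + fps_X) ^ s * (1 - fps_X) ^ (2 * k + 1 + m - s))) k
    = (if s = 2 * k + 1 then 2 ^ (2 * k) else 0)"
proof (cases "s = 2 * k + 1")
  case True
  have "neg_binomial_fps m * (1 - fps_X) ^ m = neg_binomial_fps 0"
  proof -
    have "neg_binomial_fps m * (1 - fps_X) ^ m
        = (neg_binomial_fps m * (1 - fps_X) ^ m) * (neg_binomial_fps 0 * (1 - fps_X))"
      by (simp add: neg_binomial_fps_0)
    also have "\<dots> = neg_binomial_fps 0 * (neg_binomial_fps m * (1 - fps_X) ^ Suc m)"
      by (simp add: mult_ac)
    finally show ?thesis by (simp only: neg_binomial_fps_mult_power mult_1_right)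
  qed
  then have eq: "neg_binomial_fps m * ((1 + fps_X) ^ s * (1 - fps_X) ^ (2 * k + 1 + m - s))
      = neg_binomial_fps 0 * (1 + fps_X) ^ (2 * k + 1)"
    using True by (simp add: mult_ac)
  show ?thesis
    unfolding eq using True half_binomial_row_coeff[of k] by (simp only: if_True simp_thms)
next
  case False
  then have "s \<le> 2 * k" using assms by simp
  then have e: "2 * k + 1 + m - s = (2 * k - s) + Suc m" by simp
  have "neg_binomial_fps m * ((1 + fps_X) ^ s * (1 - fps_X) ^ (2 * k + 1 + m - s))
      = (1 + fps_X) ^ s * (1 - fps_X) ^ (2 * k - s) * (neg_binomial_fps m * (1 - fps_X) ^ Suc m)"
    unfolding e power_add by (simp only: mult_ac)
  also have "\<dots> = (1 + fps_X) ^ s * (1 - fps_X) ^ (2 * k - s)"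
    by (simp only: neg_binomial_fps_mult_power mult_1_right)
  finally have "fps_nth (neg_binomial_fps m * ((1 + fps_X) ^ s * (1 - fps_X) ^ (2 * k + 1 + m - s))) k
      = fps_nth ((1 + fps_X) ^ s * (1 - fps_X) ^ (2 * k - s)) k"
    by (simp only:)
  also have "\<dots> = 0"
    using \<open>s \<le> 2 * k\<close> \<open>odd s\<close> by (intro antipalindromic_middle_coeff) auto
  finally show ?thesis
    using False by (simp only: if_False)
qed

section \<open>The coefficient of a monomial\<close>

text \<open>
  Expanding \<open>\<Prod>\<^sub>i (1 - e\<^sub>i z)\<close> yields one term \<open>(-1)^|I| (\<Prod>i\<in>I. e\<^sub>i) z^|I|\<close> for each subset \<open>I\<close>. Its
  contribution to \<open>z^k\<close> picks the coefficient of \<open>z^(k - |I|)\<close> in the series, and there is none when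
  \<open>|I| > k\<close>: this is where the bound on \<open>card I\<close> comes from.
\<close>

lemma weighted_subset_sum_eq_coeff:
  fixes e :: "'a \<Rightarrow> int"
  assumes "finite A"
  shows "(\<Sum>I | I \<subseteq> A \<and> card I \<le> k.
      (-1) ^ card I * int ((m + (k - card I)) choose (k - card I)) * (\<Prod>i\<in>I. e i))
    = fps_nth (neg_binomial_fps m * (\<Prod>i\<in>A. 1 - fps_const (e i) * fps_X)) k"
proof -
  have "(\<Prod>i\<in>A. 1 - fps_const (e i) * fps_X) = (\<Prod>i\<in>A. fps_const (- e i) * fps_X + 1)"
    by (simp flip: fps_const_neg)
  also have "\<dots> = (\<Sum>I\<in>Pow A. (\<Prod>i\<in>I. fps_const (- e i) * fps_X))"
    by (subst prod_add[OF assms]) simp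
  also have "\<dots> = (\<Sum>I\<in>Pow A. fps_const ((-1) ^ card I * (\<Prod>i\<in>I. e i)) * fps_X ^ card I)"
  proof (rule sum.cong[OF refl])
    fix I assume "I \<in> Pow A"
    have "(\<Prod>i\<in>I. fps_const (- e i)) = fps_const (\<Prod>i\<in>I. - e i)"
      by (induction I rule: infinite_finite_induct) simp_all
    then show "(\<Prod>i\<in>I. fps_const (- e i) * fps_X)
        = fps_const ((-1) ^ card I * (\<Prod>i\<in>I. e i)) * fps_X ^ card I"
      by (simp add: prod.distrib prod_uminus)
  qed
  finally have "fps_nth (neg_binomial_fps m * (\<Prod>i\<in>A. 1 - fps_const (e i) * fps_X)) k
      = (\<Sum>I\<in>Pow A. fps_nth (fps_const ((-1) ^ card I * (\<Prod>i\<in>I. e i))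
          * (neg_binomial_fps m * fps_X ^ card I)) k)"
    by (simp add: sum_distrib_left fps_sum_nth mult_ac)
  also have "\<dots> = (\<Sum>I\<in>Pow A. if card I \<le> k
      then (-1) ^ card I * int ((m + (k - card I)) choose (k - card I)) * (\<Prod>i\<in>I. e i) else 0)"
    by (rule sum.cong[OF refl]) (simp only: fps_mult_left_const_nth fps_X_power_mult_right_nth, simp)
  also have "\<dots> = (\<Sum>I | I \<subseteq> A \<and> card I \<le> k.
      (-1) ^ card I * int ((m + (k - card I)) choose (k - card I)) * (\<Prod>i\<in>I. e i))"
    using assms by (subst sum.inter_filter[symmetric]) (auto intro!: sum.cong)
  finally show ?thesis by simp
qed

lemma prod_sign_linear_factors:
  fixes e :: "'a \<Rightarrow> int"
  assumes "finite A" and "\<And>i. i \<in> A \<Longrightarrow> e i = (if i \<in> S then -1 else 1)" and "S \<subseteq> A"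
  shows "(\<Prod>i\<in>A. 1 - fps_const (e i) * fps_X) = (1 + fps_X) ^ card S * (1 - fps_X) ^ (card A - card S)"
proof -
  have "(\<Prod>i\<in>A. 1 - fps_const (e i) * fps_X)
      = (\<Prod>i\<in>S. 1 - fps_const (e i) * fps_X) * (\<Prod>i\<in>A - S. 1 - fps_const (e i) * fps_X)"
    by (subst prod.subset_diff[OF assms(3,1)]) (rule mult.commute)
  also have "(\<Prod>i\<in>S. 1 - fps_const (e i) * fps_X) = (\<Prod>i\<in>S. 1 + fps_X)"
  proof (rule prod.cong[OF refl])
    fix i assume "i \<in> S"
    then have "e i = -1" using assms(2,3) by auto
    then show "1 - fps_const (e i) * fps_X = 1 + fps_X" by (simp add: fps_eq_iff)
  qed
  also have "(\<Prod>i\<in>A - S. 1 - fps_const (e i) * fps_X) = (\<Prod>i\<in>A - S. 1 - fps_X)"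
    using assms(2) by (intro prod.cong refl) simp
  finally show ?thesis
    using assms by (simp add: card_Diff_subset finite_subset)
qed

text \<open>
  Integer-valued signs make sense in every commutative ring through \<^const>\<open>of_int\<close>, which lets the
  decomposition be proved over an arbitrary commutative ring.
\<close>

definition ind_sign :: "'a set \<Rightarrow> 'a \<Rightarrow> int" where
  "ind_sign I i = (if i \<in> I then -1 else 1)"

text \<open>
  Only the parities of the fibres of \<open>f\<close> matter: exchanging the products over \<open>D\<close> and \<open>I\<close> turns the
  sign attached to \<open>I\<close> into \<open>\<Prod>i\<in>I. e i\<close>, where \<open>e i\<close> is \<open>(-1)^c\<close> for the size \<open>c\<close> of the fibre over \<open>i\<close>. So the sum depends only on the set \<open>S\<close> of points with an odd fibre.
  As the fibre sizes add up to the odd number \<open>2 * k + 1\<close>, the cardinality of \<open>S\<close> is odd and at most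
  \<open>2 * k + 1\<close>, and it reaches this bound exactly when all non-empty fibres are singletons.
\<close>

lemma monomial_coefficient:
  assumes "finite A" and card_A: "card A = 2 * k + 1 + m"
    and "finite D" and card_D: "card D = 2 * k + 1" and f: "f \<in> D \<rightarrow> A"
  shows "(\<Sum>I | I \<subseteq> A \<and> card I \<le> k.
      (-1) ^ card I * int ((m + (k - card I)) choose (k - card I)) * (\<Prod>j\<in>D. ind_sign I (f j)))
    = (if inj_on f D then 2 ^ (2 * k) else 0)"
proof -
  define e :: "'a \<Rightarrow> int" where "e i = (\<Prod>j\<in>D. if f j = i then -1 else 1)" for i
  have e: "e i = (-1) ^ card {j \<in> D. f j = i}" for i
    by (simp add: e_def prod.If_cases Int_def \<open>finite D\<close>)
  define S where "S = {i \<in> A. odd (card {j \<in> D. f j = i})}"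
  have S: "e i = (if i \<in> S then -1 else 1)" if "i \<in> A" for i
    using that by (simp add: e S_def)
  have "S \<subseteq> A" by (auto simp: S_def)
  have swap: "(\<Prod>j\<in>D. ind_sign I (f j)) = (\<Prod>i\<in>I. e i)" if "I \<subseteq> A" for I
  proof -
    have "finite I" using that \<open>finite A\<close> by (rule finite_subset)
    have "(\<Prod>i\<in>I. e i) = (\<Prod>j\<in>D. \<Prod>i\<in>I. if f j = i then -1 else 1)"
      unfolding e_def by (rule prod.swap)
    also have "\<dots> = (\<Prod>j\<in>D. ind_sign I (f j))"
      using \<open>finite I\<close> by (simp add: prod.delta' ind_sign_def)
    finally show ?thesis ..
  qed
  have S_image: "S \<subseteq> f ` D"
  proof
    fix i assume "i \<in> S"
    then have "{j \<in> D. f j = i} \<noteq> {}"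
      unfolding S_def by (metis (no_types, lifting) card.empty even_zero mem_Collect_eq)
    then show "i \<in> f ` D" by auto
  qed
  have "card S \<le> card (f ` D)" using S_image \<open>finite D\<close> by (intro card_mono) auto
  moreover have "card (f ` D) \<le> 2 * k + 1" using card_image_le[OF \<open>finite D\<close>, of f] card_D by simp
  ultimately have S_le: "card S \<le> 2 * k + 1" by simp
  have "odd (card S)"
  proof -
    \<comment> \<open>Taking \<open>I = A\<close> in the exchange of products counts every element of \<open>D\<close> once.\<close>
    have "(-1) ^ card S = (\<Prod>i\<in>A. e i)"
      using \<open>finite A\<close> \<open>S \<subseteq> A\<close> by (simp add: S prod.If_cases Int_absorb1)
    also have "\<dots> = (\<Prod>j\<in>D. ind_sign A (f j))" by (simp add: swap)
    also have "\<dots> = (\<Prod>j\<in>D. -1)" using f by (intro prod.cong) (auto simp: ind_sign_def)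
    also have "\<dots> = -1" by (simp add: card_D)
    finally show ?thesis by (metis one_neq_neg_one power_minus_even power_one)
  qed
  have inj: "card S = 2 * k + 1 \<longleftrightarrow> inj_on f D"
  proof
    assume "card S = 2 * k + 1"
    with \<open>card S \<le> card (f ` D)\<close> \<open>card (f ` D) \<le> 2 * k + 1\<close> have "card (f ` D) = card D" by (simp add: card_D)
    then show "inj_on f D" by (simp add: eq_card_imp_inj_on \<open>finite D\<close>)
  next
    assume inj: "inj_on f D"
    have "f ` D \<subseteq> S"
    proof
      fix i assume "i \<in> f ` D"
      then obtain j where "j \<in> D" "i = f j" by auto
      then have "{j' \<in> D. f j' = i} = {j}" using inj by (auto dest: inj_onD)
      then show "i \<in> S" using f \<open>j \<in> D\<close> \<open>i = f j\<close> by (auto simp: S_def)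
    qed
    with S_image have "S = f ` D" by simp
    then show "card S = 2 * k + 1" using card_image[OF inj] card_D by simp
  qed
  have "(\<Sum>I | I \<subseteq> A \<and> card I \<le> k.
      (-1) ^ card I * int ((m + (k - card I)) choose (k - card I)) * (\<Prod>j\<in>D. ind_sign I (f j)))
    = fps_nth (neg_binomial_fps m * (\<Prod>i\<in>A. 1 - fps_const (e i) * fps_X)) k"
    by (subst weighted_subset_sum_eq_coeff[OF \<open>finite A\<close>, symmetric]) (auto intro!: sum.cong simp: swap)
  also have "\<dots> = (if card S = 2 * k + 1 then 2 ^ (2 * k) else 0)"
    by (simp only: prod_sign_linear_factors[OF \<open>finite A\<close> S \<open>S \<subseteq> A\<close>] card_A
        generating_function_coeff[OF \<open>odd (card S)\<close> S_le])
  finally show ?thesis by (simp only: inj)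
qed

section \<open>The power sum decomposition\<close>

text \<open>
  Group the injective functions by their image \<open>I\<close>: each of the \<open>d!\<close> bijections onto \<open>I\<close> contributes
  the same product.
\<close>

lemma sum_prod_injective_functions:
  fixes x :: "'a \<Rightarrow> 'b :: comm_ring_1"
  assumes "finite A"
  shows "(\<Sum>f | f \<in> {..<d} \<rightarrow>\<^sub>E A \<and> inj_on f {..<d}. \<Prod>j<d. x (f j))
    = of_nat (fact d) * (\<Sum>I | I \<subseteq> A \<and> card I = d. \<Prod>i\<in>I. x i)"
proof -
  let ?D = "{..<d}"
  let ?F = "{f. f \<in> ?D \<rightarrow>\<^sub>E A \<and> inj_on f ?D}"
  let ?T = "{I. I \<subseteq> A \<and> card I = d}"
  have "finite (?D \<rightarrow>\<^sub>E A)" using assms by (intro finite_PiE) auto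
  then have fin: "finite ?F" by (rule finite_subset[rotated]) auto
  have finT: "finite ?T" using assms by simp
  have "(\<Sum>f\<in>?F. \<Prod>j<d. x (f j)) = (\<Sum>I\<in>?T. \<Sum>f | f \<in> ?F \<and> f ` ?D = I. \<Prod>j<d. x (f j))"
    by (rule sum.group[OF fin finT, symmetric]) (auto simp: card_image PiE_iff)
  also have "\<dots> = (\<Sum>I\<in>?T. of_nat (fact d) * (\<Prod>i\<in>I. x i))"
  proof (rule sum.cong[OF refl])
    fix I assume I: "I \<in> ?T"
    then have "finite I" using assms finite_subset by auto
    have eq: "{f. f \<in> ?F \<and> f ` ?D = I} = {f \<in> ?D \<rightarrow>\<^sub>E I. inj_on f ?D}"
    proof (intro equalityI subsetI)
      fix f assume "f \<in> {f \<in> ?D \<rightarrow>\<^sub>E I. inj_on f ?D}"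
      then have f: "f \<in> ?D \<rightarrow>\<^sub>E I" "inj_on f ?D" by auto
      have "f ` ?D = I"
        using f I \<open>finite I\<close> by (intro card_subset_eq) (auto simp: card_image)
      then show "f \<in> {f. f \<in> ?F \<and> f ` ?D = I}" using f I by (auto simp: PiE_iff)
    qed (auto simp: PiE_iff)
    have "(\<Sum>f | f \<in> ?F \<and> f ` ?D = I. \<Prod>j<d. x (f j)) = (\<Sum>f | f \<in> ?F \<and> f ` ?D = I. \<Prod>i\<in>I. x i)"
    proof (rule sum.cong[OF refl])
      fix f assume "f \<in> {f. f \<in> ?F \<and> f ` ?D = I}"
      then have "inj_on f ?D" "I = f ` ?D" by auto
      then show "(\<Prod>j<d. x (f j)) = (\<Prod>i\<in>I. x i)" by (simp only: prod.reindex comp_def)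
    qed
    also have "\<dots> = of_nat (card {f \<in> ?D \<rightarrow>\<^sub>E I. inj_on f ?D}) * (\<Prod>i\<in>I. x i)"
      by (simp only: eq sum_constant)
    also have "card {f \<in> ?D \<rightarrow>\<^sub>E I. inj_on f ?D} = fact d"
      using card_inj_on_subset_funcset[of ?D I ?D] \<open>finite I\<close> I by (simp add: fact_prod_rev)
    finally show "(\<Sum>f | f \<in> ?F \<and> f ` ?D = I. \<Prod>j<d. x (f j)) = of_nat (fact d) * (\<Prod>i\<in>I. x i)"
      by simp
  qed
  finally show ?thesis by (simp add: sum_distrib_left)
qed

text \<open>
  The identity holds for arbitrary elements \<open>x i\<close> of a commutative ring, since all coefficients
  involved are integers.
\<close>

theorem power_sum_decomposition:
  fixes x :: "'a \<Rightarrow> 'b :: comm_ring_1"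
  assumes "finite A" and d: "d = 2 * k + 1" and "card A \<ge> d"
  shows "2 ^ (2 * k) * of_nat (fact d) * (\<Sum>I | I \<subseteq> A \<and> card I = d. \<Prod>i\<in>I. x i) =
    (\<Sum>I | I \<subseteq> A \<and> card I \<le> k.
       (-1) ^ card I * of_nat ((card A - k - card I - 1) choose (k - card I)) *
       (\<Sum>i\<in>A. of_int (ind_sign I i) * x i) ^ d)"
proof -
  let ?F = "{..<d} \<rightarrow>\<^sub>E A"
  let ?T = "{I. I \<subseteq> A \<and> card I \<le> k}"
  define m where "m = card A - d"
  have m: "card A = d + m" using \<open>card A \<ge> d\<close> by (simp add: m_def)
  define w :: "'a set \<Rightarrow> int"
    where "w I = (-1) ^ card I * int ((m + (k - card I)) choose (k - card I))" for I
  have finF: "finite ?F" using assms(1) by (intro finite_PiE) auto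
  have "(\<Sum>I\<in>?T. (-1) ^ card I * of_nat ((card A - k - card I - 1) choose (k - card I)) *
       (\<Sum>i\<in>A. of_int (ind_sign I i) * x i) ^ d)
    = (\<Sum>I\<in>?T. of_int (w I) *
        (\<Sum>f\<in>?F. of_int (\<Prod>j<d. ind_sign I (f j)) * (\<Prod>j<d. x (f j))))"
  proof (rule sum.cong[OF refl])
    fix I assume "I \<in> ?T"
    then have "card A - k - card I - 1 = m + (k - card I)" using m d by auto
    then have "(-1) ^ card I * of_nat ((card A - k - card I - 1) choose (k - card I))
        = (of_int (w I) :: 'b)"
      by (simp add: w_def)
    moreover have "(\<Sum>i\<in>A. of_int (ind_sign I i) * x i) ^ d
        = (\<Sum>f\<in>?F. of_int (\<Prod>j<d. ind_sign I (f j)) * (\<Prod>j<d. x (f j)))"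
      using prod_sum_PiE[of "{..<d}" "\<lambda>_. A" "\<lambda>_ i. of_int (ind_sign I i) * x i"] assms(1)
      by (simp only: prod_constant card_lessThan finite_lessThan simp_thms prod.distrib of_int_prod)
    ultimately show "(-1) ^ card I * of_nat ((card A - k - card I - 1) choose (k - card I)) *
        (\<Sum>i\<in>A. of_int (ind_sign I i) * x i) ^ d = of_int (w I) *
        (\<Sum>f\<in>?F. of_int (\<Prod>j<d. ind_sign I (f j)) * (\<Prod>j<d. x (f j)))"
      by (simp only:)
  qed
  also have "\<dots> = (\<Sum>f\<in>?F. of_int (\<Sum>I\<in>?T. w I * (\<Prod>j<d. ind_sign I (f j))) * (\<Prod>j<d. x (f j)))"
    unfolding sum_distrib_left of_int_sum sum_distrib_right of_int_mult mult.assoc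
    by (rule sum.swap)
  also have "\<dots> = (\<Sum>f\<in>?F. if inj_on f {..<d} then 2 ^ (2 * k) * (\<Prod>j<d. x (f j)) else 0)"
  proof (rule sum.cong[OF refl])
    fix f assume "f \<in> ?F"
    then have "f \<in> {..<d} \<rightarrow> A" by (auto simp: PiE_iff)
    moreover have "card A = 2 * k + 1 + m" "card {..<d} = 2 * k + 1" using m d by simp_all
    ultimately have "(\<Sum>I\<in>?T. w I * (\<Prod>j<d. ind_sign I (f j)))
        = (if inj_on f {..<d} then 2 ^ (2 * k) else 0)"
      unfolding w_def by (intro monomial_coefficient) (use assms(1) in simp_all)
    then show "of_int (\<Sum>I\<in>?T. w I * (\<Prod>j<d. ind_sign I (f j))) * (\<Prod>j<d. x (f j))
        = (if inj_on f {..<d} then 2 ^ (2 * k) * (\<Prod>j<d. x (f j)) else 0)"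
      by simp
  qed
  also have "\<dots> = (\<Sum>f | f \<in> ?F \<and> inj_on f {..<d}. 2 ^ (2 * k) * (\<Prod>j<d. x (f j)))"
    by (rule sum.inter_filter[symmetric, OF finF])
  also have "\<dots> = 2 ^ (2 * k) * (of_nat (fact d) * (\<Sum>I | I \<subseteq> A \<and> card I = d. \<Prod>i\<in>I. x i))"
    by (simp only: sum_distrib_left[symmetric] sum_prod_injective_functions[OF assms(1)])
  finally show ?thesis by (simp only: mult.assoc)
qed

text \<open>
  Every constant in the decomposition is an integer, so this one rule transports all of them from
  the complex numbers into the polynomial ring.
\<close>

lemma Const_of_int: "Const (of_int z) = of_int z"
  by (simp add: Const_def)

lemma Const_delta: "Const (delta I i) = of_int (ind_sign I i)"
proof -
  have "delta I i = of_int (ind_sign I i)"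
    by (simp add: delta_def ind_sign_def)
  then show ?thesis
    by (simp only: Const_of_int)
qed

theorem theorem2p1:
  fixes k d n :: nat
  assumes "d = 2 * k + 1" and "n \<ge> d"
  shows "Const (2 ^ (d - 1) * fact d) * elem_sym d n =
    (\<Sum>I | I \<subseteq> {1..n} \<and> card I \<le> k.
       Const ((-1) ^ card I * of_nat ((n - k - card I - 1) choose (k - card I))) *
       (\<Sum>i=1..n. Const (delta I i) * Var i) ^ d)"
proof -
  have c1: "Const (2 ^ (d - 1) * fact d) = 2 ^ (2 * k) * of_nat (fact d)"
    using Const_of_int[of "2 ^ (2 * k) * int (fact d)"] assms(1)
    by (simp only: of_int_mult of_int_power of_int_numeral of_int_fact of_nat_fact diff_add_inverse2)
  have c2: "Const ((-1) ^ a * of_nat b) = (-1) ^ a * of_nat b" for a b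
    using Const_of_int[of "(-1) ^ a * int b"] by simp
  have "card {1..n} \<ge> d" using assms(2) by simp
  from power_sum_decomposition[OF finite_atLeastAtMost assms(1) this, of Var]
  show ?thesis
    by (simp only: c1 c2 Const_delta elem_sym_def card_atLeastAtMost diff_Suc_1)
qed

end
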